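(* Let $p,q$ be squarefree positive integers such that $K=\mathbb{Q}(\sqrt p,\sqrt q)$ is a biquadratic number field, and let $r=\frac{pq}{\gcd(p,q)^2}$. Let $\gamma\in\mathcal{O}_K^+$, and let $Q$ be a classical totally positive definite quadratic form with $n$ variables and coefficients from $\mathcal{O}_K$ representing $\gamma$. Let $\eta_i\in\mathcal{O}_K$, $i=1,\dots,n$, be such that $Q(\eta_1,\dots,\eta_n)=\gamma$, and let $\eta_i=a_i+b_i\sqrt p+c_i\sqrt q+d_i\sqrt r$ with $a_i,b_i,c_i,d_i\in\mathbb{Q}$. (a) If $Q$ is diagonal, $Q(\mathbf{x})=\sum_{i=1}^n\alpha_ix_i^2$, then for every $i$ $$\eta_i^2\preceq\frac{\gamma}{\alpha_i}.$$ In particular, $$a_i^2\leq\frac14\mathrm{Tr}\left(\frac{\gamma}{\alpha_i}\right),\quad b_i^2\leq\frac1{4p}\mathrm{Tr}\left(\frac{\gamma}{\alpha_i}\right),\quad c_i^2\leq\frac1{4q}\mathrm{Tr}\left(\frac{\gamma}{\alpha_i}\right),\quad d_i^2\leq\frac1{4r}\mathrm{Tr}\left(\frac{\gamma}{\alpha_i}\right).$$ (b) In the general case, for every $i$, $$\mathrm{Tr}(\eta_i^2)\leq\sum_{k=1}^4\sum_{j=1}^n\frac{\sigma_k(\gamma)}{\lambda_j^{(k)}},$$ where $\lambda_1^{(k)},\dots,\lambda_n^{(k)}$ are the eigenvalues of the matrix $\sigma_k(Q)$. In particular, $$a_i^2\leq\frac14\sum_{k=1}^4\sum_{j=1}^n\frac{\sigma_k(\gamma)}{\lambda_j^{(k)}},\quad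 b_i^2\leq\frac1{4p}\sum_{k=1}^4\sum_{j=1}^n\frac{\sigma_k(\gamma)}{\lambda_j^{(k)}},\quad c_i^2\leq\frac1{4q}\sum_{k=1}^4\sum_{j=1}^n\frac{\sigma_k(\gamma)}{\lambda_j^{(k)}},\quad d_i^2\leq\frac1{4r}\sum_{k=1}^4\sum_{j=1}^n\frac{\sigma_k(\gamma)}{\lambda_j^{(k)}}.$$
   Context: $\mathcal{O}_K$ is the ring of integers of $K$; $\sigma_1,\dots,\sigma_4$ are the four embeddings of $K$ into $\mathbb{C}$ (all with real image). For $\alpha,\beta\in K$, $\alpha\succ0$ (totally positive) means $\sigma_k(\alpha)>0$ for all $k$; $\beta\prec\alpha$ means $\alpha-\beta\succ0$; $\beta\preceq\alpha$ means $\beta\prec\alpha$ or $\beta=\alpha$. $\mathcal{O}_K^+=\{\alpha\in\mathcal{O}_K:\alpha\succ0\}$. $\mathrm{Tr}(\alpha)=\sum_{k=1}^4\sigma_k(\alpha)$. A quadratic form $Q(\mathbf{x})=\sum_{i,j=1}^n\alpha_{ij}x_ix_j$ with $\alpha_{ij}=\alpha_{ji}$ is identified with its symmetric matrix $(\alpha_{ij})$; it is classical if all $\alpha_{ij}\in\mathcal{O}_K$, diagonal if $\alpha_{ij}=0$ for $i\neq j$, and totally positive definite if $Q(\gamma_1,\dots,\gamma_n)\succ0$ whenever $\gamma_1,\dots,\gamma_n\in\mathcal{O}_K$ are not all zero. $\sigma_k(Q)$ denotes the real symmetric matrix $(\sigma_k(\alpha_{ij}))_{i,j=1}^n$. $Q$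 represents $\gamma$ if $\gamma=Q(\eta_1,\dots,\eta_n)$ for some $\eta_i\in\mathcal{O}_K$. A biquadratic field $\mathbb{Q}(\sqrt p,\sqrt q)$ has degree 4 over $\mathbb{Q}$. *)

theory Defs
  imports
    Complex_Main
    "HOL.Hull"
    "HOL-Library.FuncSet"
    "HOL-Computational_Algebra.Polynomial"
    "HOL-Computational_Algebra.Squarefree"
    "Jordan_Normal_Form.Char_Poly"
begin

(* Number fields are taken inside the type real, since all the fields in question are real. *)

definition is_subfield :: "real set \<Rightarrow> bool" where
  "is_subfield F \<longleftrightarrow> 0 \<in> F \<and> 1 \<in> F \<and>
     (\<forall>x\<in>F. \<forall>y\<in>F. x + y \<in> F \<and> x * y \<in> F) \<and>
     (\<forall>x\<in>F. - x \<in> F \<and> inverse x \<in> F)"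

definition rat_adjoin_sqrts :: "nat \<Rightarrow> nat \<Rightarrow> real set" where
  "rat_adjoin_sqrts p q = is_subfield hull {sqrt (real p), sqrt (real q)}"

definition degree_over_rat :: "real set \<Rightarrow> nat" where
  "degree_over_rat K = vector_space.dim (\<lambda>(c::rat) (x::real). of_rat c * x) K"

definition ring_of_integers :: "real set \<Rightarrow> real set" where
  "ring_of_integers K = {x \<in> K. algebraic_int x}"

(* The field embeddings of K into the complex numbers. Requiring them to be undefined
   outside K makes two of them equal as soon as they agree on K, so that sums over this
   set count each embedding exactly once. *)
definition embeddings :: "real set \<Rightarrow> (real \<Rightarrow> complex) set" where
  "embeddings K = {\<sigma> \<in> extensional K. \<sigma> 1 = 1 \<and>
     (\<forall>x\<in>K. \<forall>y\<in>K. \<sigma> (x + y) = \<sigma> x + \<sigma> y \<and> \<sigma> (x * y) = \<sigma> x * \<sigma> y)}"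

(* The following definitions are for totally real K, where Re only changes the type of
   the values of the embeddings; see embedding_real below. *)

definition totally_positive :: "real set \<Rightarrow> real \<Rightarrow> bool" where
  "totally_positive K \<alpha> \<longleftrightarrow> \<alpha> \<in> K \<and> (\<forall>\<sigma>\<in>embeddings K. Re (\<sigma> \<alpha>) > 0)"

definition totally_less :: "real set \<Rightarrow> real \<Rightarrow> real \<Rightarrow> bool" where
  "totally_less K \<beta> \<alpha> \<longleftrightarrow> totally_positive K (\<alpha> - \<beta>)"

definition totally_le :: "real set \<Rightarrow> real \<Rightarrow> real \<Rightarrow> bool" where
  "totally_le K \<beta> \<alpha> \<longleftrightarrow> totally_less K \<beta> \<alpha> \<or> \<beta> = \<alpha>"

definition positive_integers :: "real set \<Rightarrow> real set" where
  "positive_integers K = {\<alpha> \<in> ring_of_integers K. totally_positive K \<alpha>}"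

definition field_trace :: "real set \<Rightarrow> real \<Rightarrow> real" where
  "field_trace K \<alpha> = (\<Sum>\<sigma>\<in>embeddings K. Re (\<sigma> \<alpha>))"

definition embed_mat :: "(real \<Rightarrow> complex) \<Rightarrow> real mat \<Rightarrow> real mat" where
  "embed_mat \<sigma> Q = map_mat (\<lambda>\<alpha>. Re (\<sigma> \<alpha>)) Q"

(* Quadratic forms in n variables are identified with symmetric n by n matrices. *)

definition form_value :: "nat \<Rightarrow> real mat \<Rightarrow> real vec \<Rightarrow> real" where
  "form_value n Q x = (\<Sum>i<n. \<Sum>j<n. Q $$ (i,j) * x $ i * x $ j)"

definition integral_vecs :: "real set \<Rightarrow> nat \<Rightarrow> real vec set" where
  "integral_vecs K n = {x \<in> carrier_vec n. \<forall>i<n. x $ i \<in> ring_of_integers K}"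

definition classical_form :: "real set \<Rightarrow> nat \<Rightarrow> real mat \<Rightarrow> bool" where
  "classical_form K n Q \<longleftrightarrow> Q \<in> carrier_mat n n \<and> transpose_mat Q = Q \<and>
     (\<forall>i<n. \<forall>j<n. Q $$ (i,j) \<in> ring_of_integers K)"

definition totally_positive_definite :: "real set \<Rightarrow> nat \<Rightarrow> real mat \<Rightarrow> bool" where
  "totally_positive_definite K n Q \<longleftrightarrow>
     (\<forall>x\<in>integral_vecs K n. x \<noteq> 0\<^sub>v n \<longrightarrow> totally_positive K (form_value n Q x))"

(* l 0, ..., l (n-1) are the eigenvalues of the n by n matrix A, with multiplicity. *)
definition eigenvalues_of :: "nat \<Rightarrow> real mat \<Rightarrow> (nat \<Rightarrow> real) \<Rightarrow> bool" where
  "eigenvalues_of n A l \<longleftrightarrow> char_poly A = (\<Prod>j<n. [:- l j, 1:])"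

lemma is_subfield_rat_adjoin_sqrts: "is_subfield (rat_adjoin_sqrts p q)"
  unfolding rat_adjoin_sqrts_def by (rule hull_in) (auto simp: is_subfield_def)

lemma embedding_real:
  assumes \<sigma>: "\<sigma> \<in> embeddings (rat_adjoin_sqrts p q)" and x: "x \<in> rat_adjoin_sqrts p q"
  shows "\<sigma> x \<in> \<real>"
proof -
  define K where "K = rat_adjoin_sqrts p q"
  have K: "is_subfield K" unfolding K_def by (rule is_subfield_rat_adjoin_sqrts)
  have one: "\<sigma> 1 = 1" and add: "\<And>x y. x \<in> K \<Longrightarrow> y \<in> K \<Longrightarrow> \<sigma> (x + y) = \<sigma> x + \<sigma> y"
    and mult: "\<And>x y. x \<in> K \<Longrightarrow> y \<in> K \<Longrightarrow> \<sigma> (x * y) = \<sigma> x * \<sigma> y"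
    using \<sigma> unfolding embeddings_def K_def by auto
  have K0: "0 \<in> K" and K1: "1 \<in> K" and Kadd: "\<And>x y. x \<in> K \<Longrightarrow> y \<in> K \<Longrightarrow> x + y \<in> K"
    and Kmult: "\<And>x y. x \<in> K \<Longrightarrow> y \<in> K \<Longrightarrow> x * y \<in> K"
    and Kminus: "\<And>x. x \<in> K \<Longrightarrow> - x \<in> K" and Kinv: "\<And>x. x \<in> K \<Longrightarrow> inverse x \<in> K"
    using K unfolding is_subfield_def by auto
  have zero: "\<sigma> 0 = 0" using add[OF K0 K0] by simp
  have minus: "\<sigma> (- x) = - \<sigma> x" if "x \<in> K" for x
    using add[OF that Kminus[OF that]] zero by (simp add: eq_neg_iff_add_eq_0 add.commute)
  have inv: "\<sigma> (inverse x) = inverse (\<sigma> x)" if "x \<in> K" for x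
  proof (cases "x = 0")
    case False
    have "\<sigma> x * \<sigma> (inverse x) = 1"
      using mult[OF that Kinv[OF that]] one False by simp
    then show ?thesis by (metis inverse_unique)
  qed (simp add: zero)
  have nat: "real m \<in> K \<and> \<sigma> (real m) = of_nat m" for m
  proof (induction m)
    case 0
    then show ?case using K0 zero by simp
  next
    case (Suc m)
    then show ?case using K1 one Kadd[of 1 "real m"] add[of 1 "real m"] by simp
  qed
  have sqrt_real: "\<sigma> (sqrt (real m)) \<in> \<real>" if "sqrt (real m) \<in> K" for m
  proof -
    have "\<sigma> (sqrt (real m)) ^ 2 = of_real (sqrt (real m)) ^ 2"
      using mult[OF that that] nat[of m] by (simp add: power2_eq_square flip: of_real_mult)
    then show ?thesis by (auto simp: power2_eq_iff)
  qed
  have "x \<in> is_subfield hull {sqrt (real p), sqrt (real q)}"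
    using x unfolding rat_adjoin_sqrts_def .
  then have "x \<in> K \<and> \<sigma> x \<in> \<real>"
  proof (rule hull_induct)
    fix y assume y: "y \<in> {sqrt (real p), sqrt (real q)}"
    then have "y \<in> K" unfolding K_def rat_adjoin_sqrts_def by (rule hull_inc)
    then show "y \<in> K \<and> \<sigma> y \<in> \<real>" using y sqrt_real by auto
  next
    show "is_subfield {x. x \<in> K \<and> \<sigma> x \<in> \<real>}"
      unfolding is_subfield_def
      using K0 K1 Kadd Kmult Kminus Kinv zero one add mult minus inv by auto
  qed
  then show ?thesis by simp
qed

end

theory Submission
  imports Defs
begin

text \<open>
  Part (a): \<open>\<gamma> / \<alpha>\<^sub>i - (\<eta>\<^sub>i)\<^sup>2\<close> is the sum of the \<open>\<alpha>\<^sub>j (\<eta>\<^sub>j)\<^sup>2 / \<alpha>\<^sub>i\<close> with \<open>j \<noteq> i\<close>, which is totally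
  positive unless all these \<open>\<eta>\<^sub>j\<close> vanish.

  Part (b): let \<open>A\<close> be the image of \<open>Q\<close> under one of the four embeddings. Completing squares over \<open>K\<close>
  shows that \<open>A\<close> is positive definite on all real vectors, although positivity is only given on
  integral vectors. By Cauchy--Schwarz for the inner product of \<open>A\<close>, \<open>(v\<^sub>i)\<^sup>2\<close> is at most the form value
  of \<open>v\<close> times the \<open>i\<close>-th diagonal entry of \<open>A\<^sup>-\<^sup>1\<close>. These entries are positive and add up to the
  trace of \<open>A\<^sup>-\<^sup>1\<close>, which is the sum of the reciprocal eigenvalues.

  The bounds on the coefficients follow from
  \<open>Tr (\<eta>\<^sup>2) = 4 (a\<^sup>2 + p b\<^sup>2 + q c\<^sup>2 + r d\<^sup>2)\<close>.
\<close>

subsection \<open>Subfields of the reals and their homomorphisms\<close>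

lemma subfield_closed:
  assumes "is_subfield K"
  shows "0 \<in> K" "1 \<in> K" "x \<in> K \<Longrightarrow> y \<in> K \<Longrightarrow> x + y \<in> K" "x \<in> K \<Longrightarrow> y \<in> K \<Longrightarrow> x * y \<in> K"
    "x \<in> K \<Longrightarrow> - x \<in> K" "x \<in> K \<Longrightarrow> y \<in> K \<Longrightarrow> x - y \<in> K"
    "x \<in> K \<Longrightarrow> inverse x \<in> K" "x \<in> K \<Longrightarrow> y \<in> K \<Longrightarrow> x / y \<in> K" "x \<in> K \<Longrightarrow> x ^ m \<in> K"
proof -
  show *: "0 \<in> K" "1 \<in> K" "x \<in> K \<Longrightarrow> y \<in> K \<Longrightarrow> x + y \<in> K" "x \<in> K \<Longrightarrow> y \<in> K \<Longrightarrow> x * y \<in> K"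
    "x \<in> K \<Longrightarrow> - x \<in> K" "x \<in> K \<Longrightarrow> inverse x \<in> K" for x y
    using assms by (auto simp: is_subfield_def)
  show "x \<in> K \<Longrightarrow> y \<in> K \<Longrightarrow> x - y \<in> K" using *(3)[of x "- y"] *(5)[of y] by simp
  show "x \<in> K \<Longrightarrow> y \<in> K \<Longrightarrow> x / y \<in> K" using *(4)[of x "inverse y"] *(6)[of y] by (simp add: divide_inverse)
  show "x \<in> K \<Longrightarrow> x ^ m \<in> K" by (induction m) (auto intro: *)
qed

lemma subfield_sum:
  assumes "is_subfield K" "\<And>i. i \<in> I \<Longrightarrow> g i \<in> K"
  shows "sum g I \<in> K"
  using assms(2) by (induction I rule: infinite_finite_induct) (auto intro: subfield_closed[OF assms(1)])

lemma subfield_of_nat: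
  assumes "is_subfield K" shows "of_nat m \<in> K"
  by (induction m) (auto intro: subfield_closed[OF assms])

lemma subfield_of_int:
  assumes "is_subfield K" shows "of_int m \<in> K"
  by (cases m) (auto intro: subfield_closed[OF assms] subfield_of_nat[OF assms] simp del: of_nat_Suc)

lemma subfield_of_rat:
  assumes "is_subfield K" shows "of_rat m \<in> K"
  by (cases m) (auto simp: of_rat_rat intro: subfield_closed[OF assms] subfield_of_int[OF assms])

text \<open>Instantiated below by the real parts of embeddings. As embeddings take real values on
  \<open>K\<close>, these are homomorphisms on \<open>K\<close>, and their values can serve as
  entries of real matrices.\<close>

locale subfield_hom =
  fixes K :: "real set" and \<tau> :: "real \<Rightarrow> real"
  assumes subfield: "is_subfield K"
    and hom_one: "\<tau> 1 = 1"
    and hom_add: "\<lbrakk>x \<in> K; y \<in> K\<rbrakk> \<Longrightarrow> \<tau> (x + y) = \<tau> x + \<tau> y"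
    and hom_mult: "\<lbrakk>x \<in> K; y \<in> K\<rbrakk> \<Longrightarrow> \<tau> (x * y) = \<tau> x * \<tau> y"

context subfield_hom
begin

lemmas closed = subfield_closed[OF subfield] subfield_sum[OF subfield] subfield_of_rat[OF subfield]
  subfield_of_nat[OF subfield] subfield_of_int[OF subfield]

lemma hom_zero: "\<tau> 0 = 0"
  using hom_add[of 0 0] closed(1) by simp

lemma hom_uminus: "x \<in> K \<Longrightarrow> \<tau> (- x) = - \<tau> x"
  using hom_add[of x "- x"] closed(5)[of x] hom_zero by simp

lemma hom_diff: "\<lbrakk>x \<in> K; y \<in> K\<rbrakk> \<Longrightarrow> \<tau> (x - y) = \<tau> x - \<tau> y"
  using hom_add[of x "- y"] hom_uminus[of y] closed(5)[of y] by simp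

lemma hom_inverse: "x \<in> K \<Longrightarrow> \<tau> (inverse x) = inverse (\<tau> x)"
proof (cases "x = 0")
  case False
  assume "x \<in> K"
  then have "\<tau> x * \<tau> (inverse x) = 1"
    using hom_mult[of x "inverse x"] closed(7)[of x] hom_one False by simp
  then show ?thesis by (metis inverse_unique)
qed (simp add: hom_zero)

lemma hom_divide: "\<lbrakk>x \<in> K; y \<in> K\<rbrakk> \<Longrightarrow> \<tau> (x / y) = \<tau> x / \<tau> y"
  using hom_mult[of x "inverse y"] hom_inverse[of y] closed(7)[of y] by (simp add: divide_inverse)

lemma hom_power: "x \<in> K \<Longrightarrow> \<tau> (x ^ m) = \<tau> x ^ m"
  by (induction m) (auto simp: hom_one hom_mult closed)

lemma hom_sum: "(\<And>i. i \<in> I \<Longrightarrow> g i \<in> K) \<Longrightarrow> \<tau> (sum g I) = (\<Sum>i\<in>I. \<tau> (g i))"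
  by (induction I rule: infinite_finite_induct) (auto simp: hom_zero hom_add closed)

lemma hom_of_nat: "\<tau> (of_nat m) = of_nat m"
  by (induction m) (auto simp: hom_zero hom_one hom_add closed)

lemma hom_of_int: "\<tau> (of_int m) = of_int m"
  by (cases m) (auto simp: hom_of_nat hom_uminus closed simp del: of_nat_Suc)

lemma hom_of_rat: "\<tau> (of_rat m) = of_rat m"
  by (cases m) (auto simp: of_rat_rat hom_of_int hom_divide closed)

end

subsection \<open>Positive definite forms\<close>

text \<open>Elimination of the last variable with pivot \<open>f n n\<close>; the coefficients of
  the remaining form are those of the Schur complement.\<close>

lemma complete_square_last:
  fixes f :: "nat \<Rightarrow> nat \<Rightarrow> real"
  assumes sym: "\<And>i. i < n \<Longrightarrow> f n i = f i n" and nz: "f n n \<noteq> 0"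
  shows "(\<Sum>i<Suc n. \<Sum>j<Suc n. f i j * y i * y j) =
    (\<Sum>i<n. \<Sum>j<n. (f i j - f i n * f n j / f n n) * y i * y j)
      + f n n * (y n + (\<Sum>i<n. f i n * y i) / f n n)\<^sup>2"
proof -
  define L where "L = (\<Sum>i<n. f i n * y i)"
  have L': "(\<Sum>j<n. f n j * y j) = L"
    unfolding L_def by (rule sum.cong) (use sym in auto)
  have "(\<Sum>i<Suc n. \<Sum>j<Suc n. f i j * y i * y j) =
      (\<Sum>i<n. \<Sum>j<n. f i j * y i * y j) + (\<Sum>i<n. f i n * y i) * y n
        + y n * (\<Sum>j<n. f n j * y j) + f n n * y n * y n"
    by (simp add: sum.distrib sum_distrib_left sum_distrib_right mult_ac)
  also have "\<dots> = (\<Sum>i<n. \<Sum>j<n. f i j * y i * y j) + 2 * L * y n + f n n * y n * y n"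
    unfolding L' by (simp add: L_def)
  finally have 1: "(\<Sum>i<Suc n. \<Sum>j<Suc n. f i j * y i * y j) = \<dots>" .
  have "(\<Sum>i<n. \<Sum>j<n. (f i j - f i n * f n j / f n n) * y i * y j) =
      (\<Sum>i<n. \<Sum>j<n. f i j * y i * y j) - (\<Sum>i<n. \<Sum>j<n. (f i n * y i) * (f n j * y j) / f n n)"
    by (simp add: sum_subtractf[symmetric] algebra_simps)
  also have "(\<Sum>i<n. \<Sum>j<n. (f i n * y i) * (f n j * y j) / f n n)
      = L * (\<Sum>j<n. f n j * y j) / f n n"
    by (simp only: L_def sum_product sum_divide_distrib)
  also have "\<dots> = L * L / f n n" by (simp only: L')
  finally have 2: "(\<Sum>i<n. \<Sum>j<n. (f i j - f i n * f n j / f n n) * y i * y j) =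
      (\<Sum>i<n. \<Sum>j<n. f i j * y i * y j) - L * L / f n n" .
  have "f n n * (y n + L / f n n)\<^sup>2 = L * L / f n n + 2 * L * y n + f n n * y n * y n"
    using nz by (simp add: field_simps power2_eq_square)
  then show ?thesis unfolding 1 2 L_def[symmetric] by simp
qed

text \<open>Positivity at the points coming from \<open>K\<close> would, by continuity alone, only
  give semidefiniteness. Induction on \<open>n\<close> gives the strict inequality: the Schur
  complement \<open>g\<close> of the pivot is again defined over \<open>K\<close>, inherits the
  positivity hypothesis, and is carried by \<open>\<tau>\<close> to the Schur complement of the
  image.\<close>

lemma (in subfield_hom) pos_def_transfer:
  fixes f :: "nat \<Rightarrow> nat \<Rightarrow> real"
  assumes "\<And>i j. i < n \<Longrightarrow> j < n \<Longrightarrow> f i j \<in> K"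
    and "\<And>i j. i < n \<Longrightarrow> j < n \<Longrightarrow> f i j = f j i"
    and "\<And>x. (\<And>i. i < n \<Longrightarrow> x i \<in> K) \<Longrightarrow> \<exists>i<n. x i \<noteq> 0 \<Longrightarrow>
            \<tau> (\<Sum>i<n. \<Sum>j<n. f i j * x i * x j) > 0"
    and "\<exists>i<n. y i \<noteq> 0"
  shows "(\<Sum>i<n. \<Sum>j<n. \<tau> (f i j) * y i * y j) > 0"
  using assms
proof (induction n arbitrary: f y)
  case (Suc n)
  have fK: "f i j \<in> K" if "i \<le> n" "j \<le> n" for i j using Suc.prems(1) that by simp
  have sym: "f i j = f j i" if "i \<le> n" "j \<le> n" for i j using Suc.prems(2) that by simp
  note pos = Suc.prems(3)
  \<comment> \<open>The last unit vector as test vector shows that the pivot has positive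
    image.\<close>
  have "(\<Sum>i<Suc n. \<Sum>j<Suc n. f i j * of_bool (i = n) * of_bool (j = n)) = f n n"
    by (simp add: of_bool_def if_distrib cong: if_cong)
  then have fnn: "\<tau> (f n n) > 0"
    using pos[of "\<lambda>i. of_bool (i = n)"] by (auto simp: closed)
  then have nz: "f n n \<noteq> 0" using hom_zero by auto
  define g where "g i j = f i j - f i n * f n j / f n n" for i j
  have gK: "g i j \<in> K" if "i < n" "j < n" for i j
    using that by (auto simp: g_def intro!: closed fK)
  have g_pos: "(\<Sum>i<n. \<Sum>j<n. \<tau> (g i j) * z i * z j) > 0" if "\<exists>i<n. z i \<noteq> 0" for z
  proof (rule Suc.IH)
    show "g i j = g j i" if "i < n" "j < n" for i j
      using that sym[of i j] sym[of i n] sym[of j n] by (simp add: g_def)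
  next
    fix x assume x: "\<And>i. i < n \<Longrightarrow> x i \<in> K" and ex: "\<exists>i<n. x i \<noteq> 0"
    define L where "L = (\<Sum>i<n. f i n * x i)"
    \<comment> \<open>this choice of the last coordinate annihilates the completed square\<close>
    define x' where "x' = x(n := - (L / f n n))"
    have LK: "L \<in> K" unfolding L_def by (intro closed fK x) auto
    have x': "(\<Sum>i<n. f i n * x' i) = L" "\<And>i. i < n \<Longrightarrow> x' i = x i" "x' n = - (L / f n n)"
      by (auto simp: x'_def L_def)
    have "(\<Sum>i<Suc n. \<Sum>j<Suc n. f i j * x' i * x' j) = (\<Sum>i<n. \<Sum>j<n. g i j * x' i * x' j)"
      using complete_square_last[of n f x'] sym nz x'(1,3) by (simp add: g_def)
    also have "\<dots> = (\<Sum>i<n. \<Sum>j<n. g i j * x i * x j)"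
      using x'(2) by simp
    finally have *: "(\<Sum>i<n. \<Sum>j<n. g i j * x i * x j) = (\<Sum>i<Suc n. \<Sum>j<Suc n. f i j * x' i * x' j)" ..
    show "\<tau> (\<Sum>i<n. \<Sum>j<n. g i j * x i * x j) > 0"
      unfolding * by (rule pos) (use ex x' LK x fK in \<open>auto simp: less_Suc_eq intro!: closed\<close>)
  qed (use gK that in auto)
  have tg: "\<tau> (g i j) = \<tau> (f i j) - \<tau> (f i n) * \<tau> (f n j) / \<tau> (f n n)" if "i < n" "j < n" for i j
    using that fK unfolding g_def by (simp add: hom_diff hom_divide hom_mult closed)
  have "(\<Sum>i<n. \<Sum>j<n. (\<tau> (f i j) - \<tau> (f i n) * \<tau> (f n j) / \<tau> (f n n)) * y i * y j)
      = (\<Sum>i<n. \<Sum>j<n. \<tau> (g i j) * y i * y j)"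
    by (intro sum.cong refl) (use tg in auto)
  then have eq: "(\<Sum>i<Suc n. \<Sum>j<Suc n. \<tau> (f i j) * y i * y j) =
      (\<Sum>i<n. \<Sum>j<n. \<tau> (g i j) * y i * y j)
      + \<tau> (f n n) * (y n + (\<Sum>i<n. \<tau> (f i n) * y i) / \<tau> (f n n))\<^sup>2"
    using complete_square_last[of n "\<lambda>i j. \<tau> (f i j)" y] fnn sym by simp
  \<comment> \<open>If one of the first \<open>n\<close> coordinates is nonzero, the first summand
    of \<open>eq\<close> is positive. Otherwise that summand and the linear form vanish, and
    \<open>\<tau> (f n n) * (y n)\<^sup>2\<close> remains.\<close>
  show ?case
  proof (cases "\<exists>i<n. y i \<noteq> 0")
    case True
    then show ?thesis unfolding eq using g_pos[OF True] fnn
      by (intro add_pos_nonneg mult_nonneg_nonneg) auto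
  next
    case False
    then have "y n \<noteq> 0" using Suc.prems(4) by (auto simp: less_Suc_eq)
    then show ?thesis unfolding eq using False fnn by auto
  qed
qed auto

section \<open>Coordinate bounds from the eigenvalues of a positive definite matrix\<close>

lemma form_value_eq_scalar_prod:
  assumes "A \<in> carrier_mat n n" "x \<in> carrier_vec n"
  shows "form_value n A x = x \<bullet> (A *\<^sub>v x)"
  using assms unfolding form_value_def scalar_prod_def mult_mat_vec_def
  by (auto simp: sum_distrib_left atLeast0LessThan mult_ac intro!: sum.cong)

text \<open>Both sides are, up to sign, the linear coefficient of the characteristic polynomial.\<close>

lemma sum_principal_minors_eq_sum_inverse_eigenvalues:
  fixes A :: "real mat"
  assumes A: "A \<in> carrier_mat n n" and l: "eigenvalues_of n A l" and det: "det A \<noteq> 0"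
  shows "(\<Sum>i<n. det (mat_delete A i i)) = det A * (\<Sum>j<n. 1 / l j)"
proof (cases n)
  case (Suc m)
  have at0: "poly (char_poly B) 0 = (-1) ^ k * det B" if "B \<in> carrier_mat k k" for B :: "real mat" and k
  proof -
    have "- char_matrix B 0 = (-1) \<cdot>\<^sub>m B" using that by (auto simp: char_matrix_def)
    then show ?thesis using char_poly_matrix[OF that, of 0] that by (simp add: det_smult)
  qed
  have sgn: "(-1::real) ^ n = - ((-1) ^ m)" by (simp add: Suc)
  have cp: "char_poly A = (\<Prod>j<n. [:- l j, 1:])" using l by (simp add: eigenvalues_of_def)
  have p0: "(-1) ^ n * det A = (\<Prod>j<n. - l j)"
    using at0[OF A] by (simp add: cp poly_prod)
  then have nz: "(\<Prod>j<n. - l j) \<noteq> 0"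
    using det by (metis mult_eq_0_iff power_eq_0_iff neg_equal_0_iff_equal zero_neq_one)
  have lnz: "l j \<noteq> 0" if "j < n" for j using nz that by auto
  \<comment> \<open>The derivative of \<open>char_poly A\<close> is the sum of the characteristic
    polynomials of the matrices with row and column \<open>i\<close> deleted. These have size
    \<open>m\<close>, hence the sign.\<close>
  have "(\<Sum>i<n. (-1) ^ m * det (mat_delete A i i)) = poly (pderiv (char_poly A)) 0"
    unfolding pderiv_char_poly[OF A] poly_sum using A
    by (intro sum.cong refl at0[symmetric]) (auto simp: Suc mat_delete_def)
  also have "\<dots> = (\<Sum>j<n. \<Prod>k\<in>{..<n} - {j}. - l k)"
    unfolding cp by (simp add: pderiv_prod poly_sum poly_prod pderiv_pCons)
  \<comment> \<open>Omitting one factor amounts to dividing by it; no \<open>l j\<close> vanishes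
    because the full product is the determinant up to sign.\<close>
  also have "\<dots> = (\<Sum>j<n. (\<Prod>k<n. - l k) * (- 1 / l j))"
    by (rule sum.cong) (use lnz in \<open>auto simp: prod.remove[of "{..<n}"]\<close>)
  also have "\<dots> = (-1) ^ m * (det A * (\<Sum>j<n. 1 / l j))"
    unfolding p0[symmetric] by (simp add: sgn sum_negf sum_distrib_left mult_ac)
  finally show ?thesis by (simp flip: sum_distrib_left)
qed simp

text \<open>The adjugate stands in for the inverse: its column \<open>w i\<close> is
  \<open>det A\<close> times column \<open>i\<close> of the inverse, so the inner product of
  \<open>w i\<close> and \<open>v\<close> with respect to \<open>A\<close> is
  \<open>det A * v $ i\<close>. Its diagonal entries \<open>m i\<close> are the principal minors of
  the preceding lemma.\<close>

lemma coordinate_le_form_value_inverse_eigenvalues: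
  fixes A :: "real mat"
  assumes A: "A \<in> carrier_mat n n" and sym: "transpose_mat A = A"
    and pos: "\<And>x. x \<in> carrier_vec n \<Longrightarrow> x \<noteq> 0\<^sub>v n \<Longrightarrow> form_value n A x > 0"
    and l: "eigenvalues_of n A l" and v: "v \<in> carrier_vec n" and i: "i < n"
  shows "(v $ i)\<^sup>2 \<le> form_value n A v * (\<Sum>j<n. 1 / l j)"
proof -
  have det: "det A \<noteq> 0"
  proof
    assume "det A = 0"
    then obtain x where x: "x \<in> carrier_vec n" "x \<noteq> 0\<^sub>v n" "A *\<^sub>v x = 0\<^sub>v n"
      using det_0_iff_vec_prod_zero[OF A] by blast
    then show False using pos[OF x(1,2)] form_value_eq_scalar_prod[OF A x(1)] by simp
  qed
  define m where "m j = det (mat_delete A j j)" for j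
  define w where "w j = col (adj_mat A) j" for j
  have adj: "adj_mat A \<in> carrier_mat n n" by (rule adj_mat(1)[OF A])
  have w: "w j \<in> carrier_vec n" "w j $ j = m j" "A *\<^sub>v w j = det A \<cdot>\<^sub>v unit_vec n j" if "j < n" for j
  proof -
    show "w j \<in> carrier_vec n" using adj unfolding w_def by (metis carrier_matD(1) col_dim)
    show "w j $ j = m j" using adj that A by (simp add: w_def m_def adj_mat_def cofactor_def)
    have "A *\<^sub>v w j = col (A * adj_mat A) j" using A adj that by (auto simp: w_def)
    also have "\<dots> = det A \<cdot>\<^sub>v unit_vec n j" unfolding adj_mat(2)[OF A] using that by auto
    finally show "A *\<^sub>v w j = det A \<cdot>\<^sub>v unit_vec n j" .
  qed
  have sp: "x \<bullet> (A *\<^sub>v w j) = det A * x $ j" if "x \<in> carrier_vec n" "j < n" for x j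
    using that w by simp
  have Fw: "form_value n A (w j) = det A * m j" if "j < n" for j
    using form_value_eq_scalar_prod[OF A w(1)] sp[OF w(1)] w(2) that by simp
  have wpos: "det A * m j > 0" if "j < n" for j
  proof -
    have "w j \<noteq> 0\<^sub>v n"
    proof
      assume "w j = 0\<^sub>v n"
      then have "A *\<^sub>v w j = 0\<^sub>v n" using A by auto
      then have "(det A \<cdot>\<^sub>v unit_vec n j) $ j = 0" using w(3)[OF that] that by simp
      then show False using that det by simp
    qed
    then show ?thesis using pos[OF w(1)[OF that]] Fw[OF that] by simp
  qed
  \<comment> \<open>These quotients are the diagonal entries of the inverse of
    \<open>A\<close>.\<close>
  have quot: "m j / det A > 0" if "j < n" for j
    using wpos[OF that] by (auto simp: zero_less_divide_iff zero_less_mult_iff)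
  have cs: "(v $ i)\<^sup>2 \<le> form_value n A v * (m i / det A)"
  proof -
    \<comment> \<open>\<open>t\<close> is the quotient of the inner products
      \<open>det A * v $ i\<close> and \<open>det A * m i\<close>, so \<open>t\<close> times
      \<open>w i\<close> is the orthogonal projection of \<open>v\<close> onto \<open>w i\<close>
      with respect to \<open>A\<close>. Cauchy-Schwarz then amounts to the form value of the
      orthogonal rest \<open>u\<close> being nonnegative.\<close>
    define t where "t = v $ i / m i"
    define u where "u = v - t \<cdot>\<^sub>v w i"
    have u: "u \<in> carrier_vec n" using v w(1)[OF i] by (simp add: u_def)
    have wA: "w i \<bullet> (A *\<^sub>v v) = det A * v $ i"
    proof -
      have "w i \<bullet> (A *\<^sub>v v) = (transpose_mat A *\<^sub>v w i) \<bullet> v"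
        using transpose_vec_mult_scalar[OF A v w(1)[OF i]] by simp
      then show ?thesis using sp[OF v i] sym v w(1)[OF i] A 
        by (metis comm_scalar_prod mult_mat_vec_carrier)
    qed
    have Au: "A *\<^sub>v u = A *\<^sub>v v - t \<cdot>\<^sub>v (A *\<^sub>v w i)"
      unfolding u_def using v w(1)[OF i] A by (simp add: mult_minus_distrib_mat_vec mult_mat_vec)
    have "form_value n A u = u \<bullet> (A *\<^sub>v v) - t * (u \<bullet> (A *\<^sub>v w i))"
      unfolding form_value_eq_scalar_prod[OF A u] Au using u v w(1)[OF i] A
      by (simp add: scalar_prod_minus_distrib[of _ n])
    also have "u \<bullet> (A *\<^sub>v v) = form_value n A v - t * (det A * v $ i)"
      unfolding u_def form_value_eq_scalar_prod[OF A v] wA[symmetric] using v w(1)[OF i] A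
      by (simp add: minus_scalar_prod_distrib[of _ n])
    also have "u \<bullet> (A *\<^sub>v w i) = det A * (v $ i - t * m i)"
      using sp[OF u i] i v w(1,2)[OF i] by (simp add: u_def)
    also have "v $ i - t * m i = 0" using wpos[OF i] by (auto simp: t_def)
    finally have "form_value n A v = form_value n A u + t * (det A * v $ i)" by simp
    moreover have "form_value n A u \<ge> 0"
    proof (cases "u = 0\<^sub>v n")
      case True
      then show ?thesis by (simp add: form_value_def)
    qed (use pos[OF u] in force)
    ultimately have "t * (det A * v $ i) \<le> form_value n A v" by simp
    then have "t * (det A * v $ i) * (m i / det A) \<le> form_value n A v * (m i / det A)"
      by (rule mult_right_mono) (use quot[OF i] in simp)
    moreover have "t * (det A * v $ i) * (m i / det A) = (v $ i)\<^sup>2"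
      using wpos[OF i] by (auto simp: t_def power2_eq_square)
    ultimately show ?thesis by simp
  qed
  have "m i / det A \<le> (\<Sum>j<n. m j / det A)"
    using quot i by (intro member_le_sum) (auto simp: less_imp_le)
  also have "\<dots> = (\<Sum>j<n. 1 / l j)"
    using sum_principal_minors_eq_sum_inverse_eigenvalues[OF A l det] det
    by (simp add: m_def flip: sum_divide_distrib)
  finally have "m i / det A \<le> (\<Sum>j<n. 1 / l j)" .
  moreover have "form_value n A v \<ge> 0"
    by (cases "v = 0\<^sub>v n") (use pos[OF v] in \<open>auto simp: form_value_def\<close>)
  ultimately show ?thesis using cs by (meson mult_left_mono order_trans)
qed

subsection \<open>Biquadratic fields\<close>

lemma is_subfield_Rats: "is_subfield \<rat>"
  by (auto simp: is_subfield_def)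

lemma is_subfield_adjoin_sqrt:
  assumes F: "is_subfield F" and s: "s * s \<in> F"
  shows "is_subfield {u + v * s |u v. u \<in> F \<and> v \<in> F}"
proof -
  note cl = subfield_closed[OF F]
  define E where "E = {u + v * s |u v. u \<in> F \<and> v \<in> F}"
  have I: "x \<in> E" if "x = u + v * s" "u \<in> F" "v \<in> F" for x u v
    using that unfolding E_def by blast
  have Ecases: "\<exists>u v. x = u + v * s \<and> u \<in> F \<and> v \<in> F" if x: "x \<in> E" for x
    using x unfolding E_def by blast
  have "inverse x \<in> E" if x: "x \<in> E" for x
  proof -
    obtain u v where xuv: "x = u + v * s" and uv: "u \<in> F" "v \<in> F" using Ecases[OF x] by blast
    show ?thesis
    \<comment> \<open>For \<open>s \<in> F\<close> the conjugate of a nonzero element may vanish,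
      but then \<open>x\<close> and its inverse already lie in \<open>F\<close>.\<close>
    proof (cases "s \<in> F")
      case True
      then have "inverse x \<in> F" unfolding xuv using uv by (intro cl)
      then show ?thesis using I[of "inverse x" "inverse x" 0] cl(1) by simp
    next
      case False
      show ?thesis
      proof (cases "x = 0")
        case True
        then show ?thesis using x by simp
      next
        case nz: False
        define N where "N = u * u - v * v * (s * s)"
        have NF: "N \<in> F" unfolding N_def by (intro cl uv s)
        have Neq: "N = x * (u - v * s)" by (simp add: N_def xuv algebra_simps)
        have "u - v * s \<noteq> 0"
        proof
          assume "u - v * s = 0"
          moreover from this nz xuv have "v \<noteq> 0" by auto
          ultimately have "s = u / v" by (simp add: field_simps)
          then show False using False cl(8)[OF uv] by simp
        qed
        then have "inverse x = u / N + (- v / N) * s"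
          using nz unfolding Neq by (simp add: divide_simps)
        then show ?thesis by (rule I) (auto intro!: cl uv NF)
      qed
    qed
  qed
  moreover have "- x \<in> E" if x: "x \<in> E" for x
  proof -
    obtain u v where "x = u + v * s" "u \<in> F" "v \<in> F" using Ecases[OF x] by blast
    then show ?thesis by (intro I[of _ "- u" "- v"] cl) auto
  qed
  moreover have "x + y \<in> E \<and> x * y \<in> E" if x: "x \<in> E" and y: "y \<in> E" for x y
  proof -
    obtain u v u' v' where xy: "x = u + v * s" "y = u' + v' * s"
      and F: "u \<in> F" "v \<in> F" "u' \<in> F" "v' \<in> F"
      using Ecases[OF x] Ecases[OF y] by blast
    have "x + y = (u + u') + (v + v') * s"
      "x * y = (u * u' + v * v' * (s * s)) + (u * v' + v * u') * s"
      by (simp_all add: xy algebra_simps)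
    then show ?thesis
      using I cl(3)[OF F(1,3)] cl(3)[OF F(2,4)]
        cl(3)[OF cl(4)[OF F(1,3)] cl(4)[OF cl(4)[OF F(2,4)] s]]
        cl(3)[OF cl(4)[OF F(1,4)] cl(4)[OF F(2,3)]] by blast
  qed
  moreover have "0 \<in> E" "1 \<in> E"
    using I[of 0 0 0] I[of 1 1 0] cl(1,2) by simp_all
  ultimately have "is_subfield E" by (simp add: is_subfield_def)
  then show ?thesis by (simp add: E_def)
qed

text \<open>The fourth basis element is \<open>s t\<close> instead of \<open>\<surd>r\<close>, which makes the conjugates of
  \<open>biquad (\<surd>p) (\<surd>q) a b c d\<close> the numbers \<open>biquad (\<plusminus>\<surd>p) (\<plusminus>\<surd>q) a b c d\<close>.\<close>

definition biquad :: "real \<Rightarrow> real \<Rightarrow> rat \<Rightarrow> rat \<Rightarrow> rat \<Rightarrow> rat \<Rightarrow> real" where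
  "biquad s t a b c d = of_rat a + of_rat b * s + of_rat c * t + of_rat d * (s * t)"

lemma biquad_add:
  "biquad s t a b c d + biquad s t a' b' c' d' = biquad s t (a + a') (b + b') (c + c') (d + d')"
  by (simp add: biquad_def of_rat_add algebra_simps)

lemma biquad_diff:
  "biquad s t a b c d - biquad s t a' b' c' d' = biquad s t (a - a') (b - b') (c - c') (d - d')"
  by (simp add: biquad_def of_rat_diff algebra_simps)

text \<open>The resulting coordinates involve \<open>s\<close> and \<open>t\<close> only through
  their squares, so they are the same for all choices of signs of the two roots. This is why
  changing signs is multiplicative.\<close>

lemma biquad_mult:
  assumes "s * s = of_nat p" "t * t = of_nat q"
  shows "biquad s t a b c d * biquad s t a' b' c' d' = biquad s t
    (a * a' + of_nat p * b * b' + of_nat q * c * c' + of_nat p * of_nat q * d * d')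
    (a * b' + b * a' + of_nat q * (c * d' + d * c'))
    (a * c' + c * a' + of_nat p * (b * d' + d * b'))
    (a * d' + d * a' + b * c' + c * b')"
proof -
  have P: "of_rat (of_nat p) = s * s" "of_rat (of_nat q) = t * t" using assms by auto
  show ?thesis unfolding biquad_def of_rat_add of_rat_mult P by (simp add: algebra_simps)
qed

lemma algebraic_int_biquad:
  assumes s: "s * s = real p" and t: "t * t = real q"
  shows "algebraic_int (biquad s t (of_int a) (of_int b) (of_int c) (of_int d))"
proof -
  define y where "y = biquad s t (of_int a) (of_int b) (of_int c) (of_int d)"
  \<comment> \<open>the relative conjugate of \<open>y\<close> over \<open>\<rat>(s)\<close> gives \<open>y\<^sup>2 - 2 (a + b s) y + (e + f s) = 0\<close>;
    \<open>h\<close> is the norm of this polynomial\<close>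
  define e where "e = a\<^sup>2 + b\<^sup>2 * p - q * (c\<^sup>2 + d\<^sup>2 * p)"
  define f where "f = 2 * a * b - 2 * q * c * d"
  define h where "h = [:e\<^sup>2 - p * f\<^sup>2, 4 * p * b * f - 4 * a * e,
     4 * a\<^sup>2 + 2 * e - 4 * b\<^sup>2 * p, - 4 * a, 1:]"
  have y: "y = a + b * s + c * t + d * (s * t)" by (simp add: y_def biquad_def)
  have "y * y - 2 * a * y + e = (2 * b * y - f) * s"
  proof -
    have "(y - (a + b * s)) * (y - (a + b * s)) = ((c + d * s) * t) * ((c + d * s) * t)"
      by (simp add: y algebra_simps)
    also have "\<dots> = (c + d * s) * (c + d * s) * q" by (simp add: t[symmetric])
    finally show ?thesis
      unfolding e_def f_def by (simp add: s[symmetric] power2_eq_square algebra_simps)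
  qed
  then have eq: "(y * y - 2 * a * y + e) * (y * y - 2 * a * y + e) = (2 * b * y - f) * (2 * b * y - f) * p"
    unfolding s[symmetric] by simp
  have "poly (map_poly of_int h) y = (y * y - 2 * a * y + e) * (y * y - 2 * a * y + e)
      - (2 * b * y - f) * (2 * b * y - f) * p"
    by (simp add: h_def map_poly_pCons power2_eq_square algebra_simps)
  then have "poly (map_poly of_int h) y = 0" unfolding eq by simp
  moreover have "lead_coeff h = 1" by (simp add: h_def)
  ultimately show ?thesis unfolding algebraic_int_altdef_ipoly y_def by blast
qed

lemma rat_common_denominator:
  fixes r :: "'i \<Rightarrow> rat"
  assumes "finite I"
  obtains m :: nat where "m > 0" "\<And>i. i \<in> I \<Longrightarrow> \<exists>k::int. of_nat m * r i = of_int k"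
proof -
  have "\<exists>m::nat. m > 0 \<and> (\<forall>i\<in>I. \<exists>k::int. of_nat m * r i = of_int k)"
    using assms
  proof (induction I)
    case (insert j I)
    then obtain m where m: "m > 0" "\<forall>i\<in>I. \<exists>k::int. of_nat m * r i = of_int k" by blast
    obtain u v where uv: "quotient_of (r j) = (u, v)" by fastforce
    then have v: "v > 0" by (rule quotient_of_denom_pos)
    then have vr: "of_nat (nat v) * r j = of_int u" using quotient_of_div[OF uv] by simp
    show ?case
    proof (intro exI[of _ "m * nat v"] conjI ballI)
      show "m * nat v > 0" using m v by simp
    next
      fix i assume i: "i \<in> insert j I"
      show "\<exists>k::int. of_nat (m * nat v) * r i = of_int k"
      proof (cases "i = j")
        case True
        have "of_nat (m * nat v) * r i = of_int (int m * u)" using vr True by (simp add: mult.assoc)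
        then show ?thesis by blast
      next
        case False
        then obtain k where "of_nat m * r i = of_int k" using i m by blast
        then have "of_nat (m * nat v) * r i = of_int (int (nat v) * k)" by (simp add: mult_ac)
        then show ?thesis by blast
      qed
    qed
  qed (auto intro: exI[of _ 1])
  then show ?thesis using that by blast
qed

section \<open>Coordinates in a biquadratic field\<close>

locale biquadratic =
  fixes p q :: nat and K :: "real set"
  assumes p_pos: "p > 0" and q_pos: "q > 0"
    and K_eq: "K = rat_adjoin_sqrts p q"
    and degree: "degree_over_rat K = 4"
begin

abbreviation bq :: "rat \<Rightarrow> rat \<Rightarrow> rat \<Rightarrow> rat \<Rightarrow> real" where
  "bq \<equiv> biquad (sqrt p) (sqrt q)"

lemma subfield: "is_subfield K"
  unfolding K_eq by (rule is_subfield_rat_adjoin_sqrts)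

lemma bq_in_K: "bq a b c d \<in> K"
proof -
  have "sqrt p \<in> K" "sqrt q \<in> K"
    unfolding K_eq rat_adjoin_sqrts_def by (auto intro: hull_inc)
  then show ?thesis
    using subfield_closed(3,4)[OF subfield] subfield_of_rat[OF subfield] unfolding biquad_def by simp
qed

text \<open>Adjoining one square root at a time gives a field \<open>E\<close> that contains both
  generators, hence also the hull \<open>K\<close>.\<close>

lemma K_cases:
  assumes "x \<in> K"
  obtains a b c d where "x = bq a b c d"
proof -
  define F where "F = {u + v * sqrt p |u v. u \<in> \<rat> \<and> v \<in> \<rat>}"
  define E where "E = {u + v * sqrt q |u v. u \<in> F \<and> v \<in> F}"
  have F: "is_subfield F" unfolding F_def
    by (rule is_subfield_adjoin_sqrt[OF is_subfield_Rats]) simp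
  have E: "is_subfield E" unfolding E_def
    by (rule is_subfield_adjoin_sqrt[OF F]) (simp add: subfield_of_nat[OF F])
  have FI: "u + v * sqrt p \<in> F" if "u \<in> \<rat>" "v \<in> \<rat>" for u v
    using that unfolding F_def by blast
  have EI: "u + v * sqrt q \<in> E" if "u \<in> F" "v \<in> F" for u v
    using that unfolding E_def by blast
  have "sqrt p \<in> F" using FI[of 0 1] by simp
  then have "sqrt p \<in> E" using EI[of "sqrt p" 0] subfield_closed[OF F] by simp
  moreover have "sqrt q \<in> E" using EI[of 0 1] subfield_closed[OF F] by simp
  ultimately have "K \<subseteq> E" unfolding K_eq rat_adjoin_sqrts_def
    using E by (intro hull_minimal) auto
  then have "x \<in> E" using assms by blast
  then obtain u v where x: "x = u + v * sqrt q" and uv: "u \<in> F" "v \<in> F"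
    unfolding E_def by blast
  obtain a b where u: "u = a + b * sqrt p" and "a \<in> \<rat>" "b \<in> \<rat>"
    using uv(1) unfolding F_def by blast
  moreover obtain c d where v: "v = c + d * sqrt p" and "c \<in> \<rat>" "d \<in> \<rat>"
    using uv(2) unfolding F_def by blast
  ultimately obtain a' b' c' d' where "a = of_rat a'" "b = of_rat b'" "c = of_rat c'" "d = of_rat d'"
    unfolding Rats_def by blast
  then have "x = bq a' b' c' d'" by (simp add: x u v biquad_def algebra_simps)
  then show ?thesis by (rule that)
qed

text \<open>The four numbers in \<open>B\<close> span \<open>K\<close>, and a spanning set with as
  many elements as the dimension is independent.\<close>

lemma bq_eq_0_iff: "bq a b c d = 0 \<longleftrightarrow> a = 0 \<and> b = 0 \<and> c = 0 \<and> d = 0"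
proof
  interpret vs: vector_space "\<lambda>(c::rat) (x::real). of_rat c * x"
    by unfold_locales (simp_all add: of_rat_add of_rat_mult algebra_simps)
  define B where "B = {1, sqrt p, sqrt q, sqrt p * sqrt q}"
  have fin: "finite B" by (simp add: B_def)
  have span: "K \<subseteq> vs.span B"
  proof
    fix x assume "x \<in> K"
    then obtain a b c d where x: "x = bq a b c d" by (rule K_cases)
    have "of_rat a * 1 + of_rat b * sqrt p + of_rat c * sqrt q + of_rat d * (sqrt p * sqrt q) \<in> vs.span B"
      by (intro vs.span_add vs.span_scale vs.span_base) (auto simp: B_def)
    then show "x \<in> vs.span B" unfolding x biquad_def by simp
  qed
  have dim: "vs.dim K = 4" using degree unfolding degree_over_rat_def .
  \<comment> \<open>As a set, \<open>B\<close> would have fewer than four elements if two of the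
    listed numbers coincided, so the dimension also shows that they are distinct.\<close>
  have "card B \<ge> 4" using vs.dim_le_card[OF span fin] dim by simp
  then have dist: "sqrt p \<noteq> 1" "sqrt q \<noteq> 1" "sqrt p * sqrt q \<noteq> 1" "sqrt p \<noteq> sqrt q"
      "sqrt p * sqrt q \<noteq> sqrt p" "sqrt p * sqrt q \<noteq> sqrt q"
    unfolding B_def by (auto simp: card_insert_if split: if_splits)
  have card: "card B = 4" using dist unfolding B_def by (auto simp: card_insert_if)
  have indep: "vs.independent B"
  \<comment> \<open>A dependent \<open>B\<close> would have a redundant element, leaving three that
    still span \<open>K\<close>.\<close>
  proof
    assume "vs.dependent B"
    then obtain z where z: "z \<in> B" "z \<in> vs.span (B - {z})" unfolding vs.dependent_def by blast
    then have "vs.span B = vs.span (B - {z})"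
      using vs.span_redundant[OF z(2)] by (simp add: insert_absorb)
    then have "vs.dim K \<le> card (B - {z})" using vs.dim_le_card[of K "B - {z}"] span fin by simp
    then show False using z(1) fin card dim by simp
  qed
  assume "bq a b c d = 0"
  define u where "u x = (if x = 1 then a else if x = sqrt p then b else if x = sqrt q then c else d)" for x
  have "(\<Sum>x\<in>B. of_rat (u x) * x) = bq a b c d"
    unfolding B_def using dist dist[symmetric] by (simp add: u_def biquad_def)
  then have "u x = 0" if "x \<in> B" for x
    using vs.independentD[OF indep fin order_refl, of u x] that \<open>bq a b c d = 0\<close> by simp
  from this[of 1] this[of "sqrt p"] this[of "sqrt q"] this[of "sqrt p * sqrt q"]
  show "a = 0 \<and> b = 0 \<and> c = 0 \<and> d = 0"
    using dist dist[symmetric] by (auto simp: u_def B_def)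
qed (simp add: biquad_def)

lemma bq_inject: "bq a b c d = bq a' b' c' d' \<longleftrightarrow> a = a' \<and> b = b' \<and> c = c' \<and> d = d'"
  using bq_eq_0_iff[of "a - a'" "b - b'" "c - c'" "d - d'"]
  unfolding biquad_diff[symmetric] by auto

text \<open>Definiteness is assumed on integral vectors; scaling by one number common to all
  coordinates carries it over to vectors over \<open>K\<close>. Clearing the denominators of the
  rational coordinates suffices, by \<open>algebraic_int_biquad\<close>.\<close>

lemma multiple_in_ring_of_integers:
  fixes n :: nat
  assumes "\<And>i. i < n \<Longrightarrow> x i \<in> K"
  obtains m :: nat where "m > 0" "\<And>i. i < n \<Longrightarrow> of_nat m * x i \<in> ring_of_integers K"
proof -
  have "\<forall>i. \<exists>a b c d. i < n \<longrightarrow> x i = bq a b c d" using assms K_cases by metis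
  then obtain a b c d where x: "\<And>i. i < n \<Longrightarrow> x i = bq (a i) (b i) (c i) (d i)" by metis
  \<comment> \<open>All coordinates are packed into one finite family, so that a single denominator
    serves them all.\<close>
  define R where "R = (\<lambda>(i, j::nat). if j = 0 then a i else if j = 1 then b i else if j = 2 then c i else d i)"
  obtain m where m: "m > 0" "\<And>z. z \<in> {..<n} \<times> {..<4} \<Longrightarrow> \<exists>k::int. of_nat m * R z = of_int k"
    by (rule rat_common_denominator[of "{..<n} \<times> {..<4::nat}" R]) auto
  show ?thesis
  proof (rule that[OF m(1)])
    fix i assume i: "i < n"
    have "\<exists>k::int. of_nat m * a i = of_int k" "\<exists>k::int. of_nat m * b i = of_int k"
      "\<exists>k::int. of_nat m * c i = of_int k" "\<exists>k::int. of_nat m * d i = of_int k"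
      using m(2)[of "(i, 0)"] m(2)[of "(i, 1)"] m(2)[of "(i, 2)"] m(2)[of "(i, 3)"] i
      by (simp_all add: R_def)
    then obtain a' b' c' d' where k: "of_nat m * a i = of_int a'" "of_nat m * b i = of_int b'"
      "of_nat m * c i = of_int c'" "of_nat m * d i = of_int d'" by blast
    have "of_nat m * x i = of_rat (of_nat m) * bq (a i) (b i) (c i) (d i)" using x[OF i] by simp
    also have "\<dots> = bq (of_nat m * a i) (of_nat m * b i) (of_nat m * c i) (of_nat m * d i)"
      unfolding biquad_def of_rat_mult by (simp add: algebra_simps)
    finally have "of_nat m * x i = bq (of_int a') (of_int b') (of_int c') (of_int d')"
      unfolding k .
    then show "of_nat m * x i \<in> ring_of_integers K"
      unfolding ring_of_integers_def using algebraic_int_biquad[of "sqrt p" p "sqrt q" q] bq_in_K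
      by simp
  qed
qed

section \<open>Embeddings and traces\<close>

lemma embedding_hom:
  assumes "\<sigma> \<in> embeddings K"
  shows "subfield_hom K (\<lambda>x. Re (\<sigma> x))"
proof
  \<comment> \<open>Vanishing imaginary parts make \<open>Re\<close> multiplicative on the values of
    \<open>\<sigma>\<close>.\<close>
  have real: "Im (\<sigma> x) = 0" if "x \<in> K" for x
    using embedding_real[of \<sigma> p q x] assms that by (simp add: K_eq complex_is_Real_iff)
  show "is_subfield K" by (rule subfield)
  show "Re (\<sigma> 1) = 1" using assms by (simp add: embeddings_def)
  show "Re (\<sigma> (x + y)) = Re (\<sigma> x) + Re (\<sigma> y)" "Re (\<sigma> (x * y)) = Re (\<sigma> x) * Re (\<sigma> y)"
    if "x \<in> K" "y \<in> K" for x y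
    using assms that real by (auto simp: embeddings_def)
qed

text \<open>The description is proper because the coordinates are unique, see \<open>bq_inject\<close>.\<close>

definition conjugation :: "real \<times> real \<Rightarrow> real \<Rightarrow> complex" where
  "conjugation = (\<lambda>(s, t). restrict (\<lambda>x. of_real (THE y. \<exists>a b c d. x = bq a b c d \<and>
     y = biquad (s * sqrt p) (t * sqrt q) a b c d)) K)"

lemma conjugation_bq:
  "conjugation (s, t) (bq a b c d) = of_real (biquad (s * sqrt p) (t * sqrt q) a b c d)"
  unfolding conjugation_def using bq_in_K by (auto simp: bq_inject intro!: the_equality)

text \<open>An embedding preserves the squares \<open>p\<close> and \<open>q\<close>, so it can only
  change the signs of the two roots, and these signs determine it on \<open>K\<close>. Conversely,
  each choice of signs respects products by \<open>biquad_mult\<close>.\<close>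

lemma embeddings_eq: "embeddings K = conjugation ` ({1, -1} \<times> {1, -1})"
proof (intro equalityI subsetI)
  fix \<sigma> assume \<sigma>: "\<sigma> \<in> embeddings K"
  define \<tau> where "\<tau> x = Re (\<sigma> x)" for x
  interpret subfield_hom K \<tau> unfolding \<tau>_def by (rule embedding_hom[OF \<sigma>])
  have sq: "sqrt p \<in> K" "sqrt q \<in> K"
    using bq_in_K[of 0 1 0 0] bq_in_K[of 0 0 1 0] by (simp_all add: biquad_def)
  have root: "\<exists>s\<in>{1, -1}. \<tau> (sqrt k) = s * sqrt k" if "sqrt k \<in> K" for k :: nat
  proof -
    have "\<tau> (sqrt k) * \<tau> (sqrt k) = sqrt k * sqrt k"
      using hom_mult[OF that that] hom_of_nat[of k] by simp
    then have "\<tau> (sqrt k) = sqrt k \<or> \<tau> (sqrt k) = - sqrt k" unfolding square_eq_iff .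
    then show ?thesis by auto
  qed
  obtain s t where st: "s \<in> {1, -1}" "t \<in> {1, -1}" "\<tau> (sqrt p) = s * sqrt p" "\<tau> (sqrt q) = t * sqrt q"
    using root[OF sq(1)] root[OF sq(2)] by blast
  have "\<sigma> x = conjugation (s, t) x" for x
  proof (cases "x \<in> K")
    case True
    then obtain a b c d where x: "x = bq a b c d" by (rule K_cases)
    have "\<tau> x = biquad (s * sqrt p) (t * sqrt q) a b c d"
      unfolding x biquad_def using sq by (simp add: hom_add hom_mult hom_of_rat closed st)
    moreover have "\<sigma> x = of_real (\<tau> x)"
      using embedding_real[of \<sigma> p q x] \<sigma> True unfolding \<tau>_def K_eq by simp
    ultimately show ?thesis by (simp add: conjugation_bq x)
  next
    \<comment> \<open>Outside \<open>K\<close> both functions are \<open>undefined\<close>.\<close>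
    case False
    then show ?thesis using \<sigma> by (simp add: embeddings_def conjugation_def extensional_def)
  qed
  then show "\<sigma> \<in> conjugation ` ({1, -1} \<times> {1, -1})" using st(1,2) by blast
next
  fix \<sigma> assume "\<sigma> \<in> conjugation ` ({1, -1} \<times> {1, -1})"
  then obtain s t where st: "s \<in> {1, -1}" "t \<in> {1, -1}" and \<sigma>: "\<sigma> = conjugation (s, t)" by blast
  have sq: "(s * sqrt p) * (s * sqrt p) = real p" "(t * sqrt q) * (t * sqrt q) = real q"
    using st by auto
  have "\<sigma> \<in> extensional K" by (simp add: \<sigma> conjugation_def)
  moreover have "\<sigma> 1 = 1"
    using conjugation_bq[of s t 1 0 0 0] by (simp add: \<sigma> biquad_def)
  moreover have "\<sigma> (x + y) = \<sigma> x + \<sigma> y \<and> \<sigma> (x * y) = \<sigma> x * \<sigma> y" if x: "x \<in> K" and y: "y \<in> K" for x y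
  proof -
    obtain a b c d where x: "x = bq a b c d" using K_cases[OF x] .
    obtain a' b' c' d' where y: "y = bq a' b' c' d'" using K_cases[OF y] .
    have sq': "sqrt p * sqrt p = real p" "sqrt q * sqrt q = real q" by auto
    show ?thesis
      unfolding \<sigma> x y biquad_add biquad_mult[OF sq'] conjugation_bq
        of_real_add[symmetric] of_real_mult[symmetric] biquad_mult[OF sq] by simp
  qed
  ultimately show "\<sigma> \<in> embeddings K" by (simp add: embeddings_def)
qed

text \<open>Different signs give different embeddings, so a sum over the embeddings becomes a sum
  over the four pairs of signs.\<close>

lemma inj_on_conjugation: "inj_on conjugation ({1, -1} \<times> {1, -1})"
proof (rule inj_onI, clarify)
  fix s t s' t' :: real
  assume "conjugation (s, t) = conjugation (s', t')"
  then have "biquad (s * sqrt p) (t * sqrt q) a b c d = biquad (s' * sqrt p) (t' * sqrt q) a b c d" for a b c d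
    using conjugation_bq[of s t a b c d] conjugation_bq[of s' t' a b c d] by (simp only: of_real_eq_iff)
  from this[of 0 1 0 0] this[of 0 0 1 0] show "s = s' \<and> t = t'"
    using p_pos q_pos by (simp add: biquad_def)
qed

text \<open>Summing over all signs cancels every coordinate except the rational one, so the trace is
  four times the rational coordinate, which \<open>biquad_mult\<close> provides for a
  square.\<close>

lemma field_trace_square:
  "field_trace K ((bq a b c d)\<^sup>2) =
     4 * ((of_rat a)\<^sup>2 + p * (of_rat b)\<^sup>2 + q * (of_rat c)\<^sup>2 + p * q * (of_rat d)\<^sup>2)"
proof -
  have sq': "sqrt p * sqrt p = real p" "sqrt q * sqrt q = real q" by auto
  have trace: "field_trace K (bq a' b' c' d') = 4 * of_rat a'" for a' b' c' d'
  proof -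
    have "field_trace K (bq a' b' c' d') =
        (\<Sum>(s, t)\<in>{1, -1} \<times> {1, -1}. biquad (s * sqrt p) (t * sqrt q) a' b' c' d')"
      unfolding field_trace_def embeddings_eq sum.reindex[OF inj_on_conjugation]
      by (intro sum.cong refl) (auto simp: conjugation_bq)
    also have "\<dots> = (\<Sum>s\<in>{1, -1}. \<Sum>t\<in>{1, -1}. biquad (s * sqrt p) (t * sqrt q) a' b' c' d')"
      by (simp only: sum.cartesian_product)
    also have "\<dots> = 4 * of_rat a'" by (simp add: biquad_def)
    finally show ?thesis .
  qed
  show ?thesis
    unfolding power2_eq_square biquad_mult[OF sq'] trace by (simp add: of_rat_add of_rat_mult mult_ac)
qed

subsection \<open>Forms over biquadratic fields\<close>

text \<open>With \<open>g\<close> the gcd, \<open>sqrt r\<close> is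
  \<open>sqrt p * sqrt q / g\<close>, so the last coordinate in the basis of \<open>bq\<close> is
  \<open>d / g\<close>; its weight \<open>p * q\<close> in the trace turns into \<open>r\<close>.
  Each of the four nonnegative summands is at most the whole sum.\<close>

lemma coefficient_bounds:
  assumes r: "r = p * q div (gcd p q)\<^sup>2"
    and x: "x = of_rat a + of_rat b * sqrt (real p) + of_rat c * sqrt (real q) + of_rat d * sqrt (real r)"
    and T: "field_trace K (x\<^sup>2) \<le> T"
  shows "(of_rat a)\<^sup>2 \<le> 1 / 4 * T" "(of_rat b)\<^sup>2 \<le> 1 / (4 * real p) * T"
    "(of_rat c)\<^sup>2 \<le> 1 / (4 * real q) * T" "(of_rat d)\<^sup>2 \<le> 1 / (4 * real r) * T"
proof -
  define g where "g = gcd p q"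
  have g: "g > 0" using p_pos by (simp add: g_def)
  \<comment> \<open>This makes the natural number division that defines \<open>r\<close>
    exact.\<close>
  have "g\<^sup>2 dvd p * q" unfolding power2_eq_square g_def by (intro mult_dvd_mono) auto
  then have rg: "r * g\<^sup>2 = p * q" unfolding r g_def by simp
  then have r_pos: "r > 0" using p_pos q_pos g by (metis mult_is_0 neq0_conv)
  have rr: "real r = real p * real q / (real g)\<^sup>2"
    using g by (simp add: field_simps flip: rg of_nat_mult of_nat_power)
  then have "sqrt (real r) = sqrt p * sqrt q / g" by (simp add: real_sqrt_divide real_sqrt_mult)
  then have "x = bq a b c (d / of_nat g)" unfolding x biquad_def by (simp add: of_rat_divide)
  then have "field_trace K (x\<^sup>2) =
      4 * ((of_rat a)\<^sup>2 + p * (of_rat b)\<^sup>2 + q * (of_rat c)\<^sup>2 + p * q * (of_rat d / g)\<^sup>2)"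
    using field_trace_square[of a b c "d / of_nat g"] by (simp add: of_rat_divide)
  also have "p * q * (of_rat d / g)\<^sup>2 = r * (of_rat d :: real)\<^sup>2" by (simp add: rr power_divide)
  finally have le: "4 * ((of_rat a)\<^sup>2 + p * (of_rat b)\<^sup>2 + q * (of_rat c)\<^sup>2 + r * (of_rat d)\<^sup>2) \<le> T"
    using T by simp
  have nn: "(of_rat a)\<^sup>2 \<ge> (0::real)" "p * (of_rat b)\<^sup>2 \<ge> (0::real)" "q * (of_rat c)\<^sup>2 \<ge> (0::real)"
    "r * (of_rat d)\<^sup>2 \<ge> (0::real)" by simp_all
  have summands: "4 * A \<le> T \<and> 4 * B \<le> T \<and> 4 * C \<le> T \<and> 4 * D \<le> T"
    if "4 * (A + B + C + D) \<le> T" "A \<ge> 0" "B \<ge> 0" "C \<ge> 0" "D \<ge> 0" for A B C D :: real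
    using that by (simp add: distrib_left)
  have "4 * (of_rat a)\<^sup>2 \<le> T" "4 * (p * (of_rat b)\<^sup>2) \<le> T" "4 * (q * (of_rat c)\<^sup>2) \<le> T" "4 * (r * (of_rat d)\<^sup>2) \<le> T"
    using summands[OF le nn] by blast+
  then show "(of_rat a)\<^sup>2 \<le> 1 / 4 * T" "(of_rat b)\<^sup>2 \<le> 1 / (4 * real p) * T"
    "(of_rat c)\<^sup>2 \<le> 1 / (4 * real q) * T" "(of_rat d)\<^sup>2 \<le> 1 / (4 * real r) * T"
    using p_pos q_pos r_pos by (simp_all add: pos_le_divide_eq mult_ac)
qed

text \<open>Scaling the vector by a common denominator \<open>m\<close> multiplies the form value by
  \<open>m * m\<close>, a positive rational number fixed by every embedding.\<close>

lemma totally_positive_on_K: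
  assumes Q: "classical_form K n Q" and pos: "totally_positive_definite K n Q"
    and x: "\<And>i. i < n \<Longrightarrow> x i \<in> K" and nz: "\<exists>i<n. x i \<noteq> 0"
  shows "totally_positive K (\<Sum>i<n. \<Sum>j<n. Q $$ (i,j) * x i * x j)" (is "totally_positive K ?S")
proof -
  obtain m :: nat where m: "m > 0" "\<And>i. i < n \<Longrightarrow> of_nat m * x i \<in> ring_of_integers K"
    using multiple_in_ring_of_integers[of n x] x by metis
  define v where "v = vec n (\<lambda>i. of_nat m * x i)"
  have QK: "Q $$ (i,j) \<in> K" if "i < n" "j < n" for i j
    using Q that unfolding classical_form_def ring_of_integers_def by blast
  have "v \<in> integral_vecs K n" using m(2) by (simp add: v_def integral_vecs_def)
  moreover have "v \<noteq> 0\<^sub>v n"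
  proof
    assume v0: "v = 0\<^sub>v n"
    obtain i where i: "i < n" "x i \<noteq> 0" using nz by blast
    then have "v $ i = 0" using v0 by simp
    then show False using i m(1) by (simp add: v_def)
  qed
  ultimately have tp: "totally_positive K (form_value n Q v)"
    using pos by (simp add: totally_positive_definite_def)
  have SK: "?S \<in> K"
    using QK x by (intro subfield_sum[OF subfield] subfield_closed[OF subfield]) auto
  have v: "form_value n Q v = of_nat (m * m) * ?S"
    by (simp add: form_value_def v_def sum_distrib_left mult_ac)
  show ?thesis unfolding totally_positive_def
  proof (intro conjI ballI SK)
    fix \<sigma> assume \<sigma>: "\<sigma> \<in> embeddings K"
    interpret subfield_hom K "\<lambda>x. Re (\<sigma> x)" by (rule embedding_hom[OF \<sigma>])
    have "Re (\<sigma> (form_value n Q v)) > 0" using tp \<sigma> by (simp add: totally_positive_def)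
    also have "Re (\<sigma> (form_value n Q v)) = of_nat (m * m) * Re (\<sigma> ?S)"
      unfolding v hom_mult[OF closed(12) SK] hom_of_nat ..
    finally show "Re (\<sigma> ?S) > 0" using m(1) by (simp add: zero_less_mult_iff)
  qed
qed

lemma embed_mat_pos_def:
  assumes Q: "classical_form K n Q" and pos: "totally_positive_definite K n Q"
    and \<sigma>: "\<sigma> \<in> embeddings K" and y: "y \<in> carrier_vec n" "y \<noteq> 0\<^sub>v n"
  shows "form_value n (embed_mat \<sigma> Q) y > 0"
proof -
  interpret subfield_hom K "\<lambda>x. Re (\<sigma> x)" by (rule embedding_hom[OF \<sigma>])
  have QK: "Q $$ (i,j) \<in> K" and sym: "Q $$ (i,j) = Q $$ (j,i)" and dim: "dim_row Q = n" "dim_col Q = n"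
    if "i < n" "j < n" for i j
  proof -
    show "Q $$ (i,j) \<in> K" using Q that unfolding classical_form_def ring_of_integers_def by blast
    show dim: "dim_row Q = n" "dim_col Q = n" using Q by (auto simp: classical_form_def)
    have "transpose_mat Q $$ (i,j) = Q $$ (j,i)" using dim that by simp
    then show "Q $$ (i,j) = Q $$ (j,i)" using Q by (simp add: classical_form_def)
  qed
  have "\<exists>i<n. y $ i \<noteq> 0"
  proof (rule ccontr)
    assume "\<not> (\<exists>i<n. y $ i \<noteq> 0)"
    then have "y = 0\<^sub>v n" using y(1) by (intro eq_vecI) auto
    then show False using y(2) by simp
  qed
  then have "(\<Sum>i<n. \<Sum>j<n. Re (\<sigma> (Q $$ (i,j))) * y $ i * y $ j) > 0"
    using totally_positive_on_K[OF Q pos] \<sigma> QK sym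
    by (intro pos_def_transfer) (auto simp: totally_positive_def)
  also have "(\<Sum>i<n. \<Sum>j<n. Re (\<sigma> (Q $$ (i,j))) * y $ i * y $ j) = form_value n (embed_mat \<sigma> Q) y"
    unfolding form_value_def by (intro sum.cong refl) (simp add: embed_mat_def dim)
  finally show ?thesis .
qed

text \<open>The contribution of a single embedding to (b), obtained from the coordinate bound for
  the conjugate matrix and the conjugate vector \<open>v\<close>.\<close>

lemma embedding_square_le:
  assumes Q: "classical_form K n Q" and pos: "totally_positive_definite K n Q"
    and \<sigma>: "\<sigma> \<in> embeddings K" and l: "eigenvalues_of n (embed_mat \<sigma> Q) l"
    and \<eta>: "\<eta> \<in> integral_vecs K n" and i: "i < n"
  shows "Re (\<sigma> ((\<eta> $ i)\<^sup>2)) \<le> (\<Sum>j<n. Re (\<sigma> (form_value n Q \<eta>)) / l j)"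
proof -
  interpret subfield_hom K "\<lambda>x. Re (\<sigma> x)" by (rule embedding_hom[OF \<sigma>])
  have QK: "Q $$ (i,j) \<in> K" if "i < n" "j < n" for i j
    using Q that unfolding classical_form_def ring_of_integers_def by blast
  have dim: "Q \<in> carrier_mat n n" and sym: "transpose_mat Q = Q"
    using Q by (simp_all add: classical_form_def)
  have \<eta>K: "\<eta> $ j \<in> K" if "j < n" for j
    using \<eta> that by (simp add: integral_vecs_def ring_of_integers_def)
  define v where "v = vec n (\<lambda>j. Re (\<sigma> (\<eta> $ j)))"
  have "transpose_mat (embed_mat \<sigma> Q) = embed_mat \<sigma> (transpose_mat Q)"
    by (rule eq_matI) (auto simp: embed_mat_def)
  then have "(v $ i)\<^sup>2 \<le> form_value n (embed_mat \<sigma> Q) v * (\<Sum>j<n. 1 / l j)"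
    using sym dim l i
    by (intro coordinate_le_form_value_inverse_eigenvalues embed_mat_pos_def[OF Q pos \<sigma>])
      (auto simp: embed_mat_def v_def)
  also have "form_value n (embed_mat \<sigma> Q) v = Re (\<sigma> (form_value n Q \<eta>))"
  proof -
    have term_K: "Q $$ (i,j) * \<eta> $ i * \<eta> $ j \<in> K" if "i < n" "j < n" for i j
      by (intro closed QK \<eta>K that)
    have "Re (\<sigma> (form_value n Q \<eta>)) = (\<Sum>i<n. Re (\<sigma> (\<Sum>j<n. Q $$ (i,j) * \<eta> $ i * \<eta> $ j)))"
      unfolding form_value_def by (intro hom_sum closed(10) term_K) simp_all
    also have "\<dots> = (\<Sum>i<n. \<Sum>j<n. Re (\<sigma> (Q $$ (i,j) * \<eta> $ i * \<eta> $ j)))"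
      by (intro sum.cong refl hom_sum term_K) simp_all
    also have "\<dots> = (\<Sum>i<n. \<Sum>j<n. Re (\<sigma> (Q $$ (i,j))) * Re (\<sigma> (\<eta> $ i)) * Re (\<sigma> (\<eta> $ j)))"
      by (intro sum.cong refl) (simp add: hom_mult closed(4) QK \<eta>K)
    also have "\<dots> = form_value n (embed_mat \<sigma> Q) v"
      unfolding form_value_def using dim by (intro sum.cong refl) (simp add: embed_mat_def v_def)
    finally show ?thesis ..
  qed
  finally show ?thesis
    using hom_power[OF \<eta>K[OF i], of 2] i by (simp add: v_def sum_distrib_left)
qed

lemma diagonal_totally_le:
  assumes Q: "classical_form K n Q" and pos: "totally_positive_definite K n Q"
    and diag: "diagonal_mat Q" and \<eta>: "\<eta> \<in> integral_vecs K n" and i: "i < n"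
  shows "totally_le K ((\<eta> $ i)\<^sup>2) (form_value n Q \<eta> / Q $$ (i,i))"
proof -
  note cl = subfield_closed[OF subfield]
  define \<alpha> where "\<alpha> j = Q $$ (j,j)" for j
  have dim: "dim_row Q = n" "dim_col Q = n" using Q by (auto simp: classical_form_def)
  have Q_ij: "Q $$ (j,k) = (if j = k then \<alpha> j else 0)" if "j < n" "k < n" for j k
    using diag that dim by (auto simp: diagonal_mat_def \<alpha>_def)
  have form: "(\<Sum>j<n. \<Sum>k<n. Q $$ (j,k) * x j * x k) = (\<Sum>j<n. \<alpha> j * (x j)\<^sup>2)" for x
  proof (rule sum.cong[OF refl])
    fix j assume j: "j \<in> {..<n}"
    have "(\<Sum>k<n. Q $$ (j,k) * x j * x k) = (\<Sum>k<n. if k = j then \<alpha> j * (x j)\<^sup>2 else 0)"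
      using j by (intro sum.cong refl) (auto simp: Q_ij power2_eq_square)
    then show "(\<Sum>k<n. Q $$ (j,k) * x j * x k) = \<alpha> j * (x j)\<^sup>2" using j by simp
  qed
  have tp: "totally_positive K (\<Sum>j<n. \<alpha> j * (x j)\<^sup>2)"
    if "\<And>j. j < n \<Longrightarrow> x j \<in> K" "\<exists>j<n. x j \<noteq> 0" for x
    using totally_positive_on_K[OF Q pos, of x] that unfolding form by blast
  \<comment> \<open>The form value at the \<open>i\<close>-th unit vector is
    \<open>\<alpha> i\<close>, which is therefore totally positive.\<close>
  have "(\<Sum>j<n. \<alpha> j * (of_bool (j = i))\<^sup>2) = (\<Sum>j<n. if j = i then \<alpha> j else 0)"
    by (intro sum.cong) auto
  also have "\<dots> = \<alpha> i" using i by simp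
  finally have "(\<Sum>j<n. \<alpha> j * (of_bool (j = i))\<^sup>2) = \<alpha> i" .
  then have \<alpha>_pos: "totally_positive K (\<alpha> i)"
    using tp[of "\<lambda>j. of_bool (j = i)"] i cl(1,2) by (auto simp: of_bool_def)
  have \<alpha>_nz: "\<alpha> i \<noteq> 0"
  proof -
    \<comment> \<open>Total positivity quantifies over embeddings, so it excludes zero only because
      an embedding exists.\<close>
    obtain \<sigma> where \<sigma>: "\<sigma> \<in> embeddings K" unfolding embeddings_eq by blast
    interpret subfield_hom K "\<lambda>x. Re (\<sigma> x)" by (rule embedding_hom[OF \<sigma>])
    show ?thesis using \<alpha>_pos \<sigma> hom_zero by (force simp: totally_positive_def)
  qed
  \<comment> \<open>With coordinate \<open>i\<close> erased, \<open>S\<close> collects the remaining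
    terms of the form. Whether \<open>x\<close> vanishes decides between equality and the strict
    relation in \<open>totally_le\<close>.\<close>
  define x where "x j = (if j = i then 0 else \<eta> $ j)" for j
  define S where "S = (\<Sum>j<n. \<alpha> j * (x j)\<^sup>2)"
  have xK: "x j \<in> K" if "j < n" for j
    using \<eta> that cl(1) by (simp add: x_def integral_vecs_def ring_of_integers_def)
  have "form_value n Q \<eta> = (\<Sum>j<n. \<alpha> j * (\<eta> $ j)\<^sup>2)"
    unfolding form_value_def by (rule form)
  also have "\<dots> = \<alpha> i * (\<eta> $ i)\<^sup>2 + S"
    unfolding S_def using i by (simp add: sum.remove[of "{..<n}" i] x_def)
  finally have S: "form_value n Q \<eta> / \<alpha> i - (\<eta> $ i)\<^sup>2 = S / \<alpha> i"
    using \<alpha>_nz by (simp add: field_simps)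
  show ?thesis
  proof (cases "\<exists>j<n. x j \<noteq> 0")
    case True
    then have S_pos: "totally_positive K S" unfolding S_def using tp xK by blast
    have "totally_positive K (S / \<alpha> i)" unfolding totally_positive_def
    proof (intro conjI ballI)
      show "S / \<alpha> i \<in> K" using S_pos \<alpha>_pos cl(8) by (simp add: totally_positive_def)
      fix \<sigma> assume \<sigma>: "\<sigma> \<in> embeddings K"
      interpret subfield_hom K "\<lambda>x. Re (\<sigma> x)" by (rule embedding_hom[OF \<sigma>])
      show "Re (\<sigma> (S / \<alpha> i)) > 0"
        using S_pos \<alpha>_pos \<sigma> hom_divide[of S "\<alpha> i"] by (simp add: totally_positive_def)
    qed
    then show ?thesis by (simp add: totally_le_def totally_less_def S flip: \<alpha>_def)
  next
    case False
    then have "S = 0" by (auto simp: S_def)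
    then show ?thesis using S by (simp add: totally_le_def flip: \<alpha>_def)
  qed
qed

lemma field_trace_mono:
  assumes "totally_le K x y" "x \<in> K"
  shows "field_trace K x \<le> field_trace K y"
  unfolding field_trace_def
proof (rule sum_mono)
  fix \<sigma> assume \<sigma>: "\<sigma> \<in> embeddings K"
  interpret subfield_hom K "\<lambda>x. Re (\<sigma> x)" by (rule embedding_hom[OF \<sigma>])
  show "Re (\<sigma> x) \<le> Re (\<sigma> y)"
  proof (cases "x = y")
    case False
    then have d: "totally_positive K (y - x)" using assms(1) by (simp add: totally_le_def totally_less_def)
    then have "y - x \<in> K" "Re (\<sigma> (y - x)) > 0" using \<sigma> by (auto simp: totally_positive_def)
    then show ?thesis using hom_add[of x "y - x"] assms(2) by simp
  qed simp
qed

end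

theorem proposition4p5:
  fixes p q r n :: nat and K :: "real set" and \<gamma> :: real
    and Q :: "real mat" and \<eta> :: "real vec" and a b c d :: "nat \<Rightarrow> rat"
  assumes "p > 0" and "squarefree p" and "q > 0" and "squarefree q"
    and "K = rat_adjoin_sqrts p q" and "degree_over_rat K = 4"
    and "r = p * q div (gcd p q)\<^sup>2"
    and "\<gamma> \<in> positive_integers K"
    and "classical_form K n Q" and "totally_positive_definite K n Q"
    and "\<eta> \<in> integral_vecs K n" and "form_value n Q \<eta> = \<gamma>"
    and "\<forall>i<n. \<eta> $ i = of_rat (a i) + of_rat (b i) * sqrt (real p)
                  + of_rat (c i) * sqrt (real q) + of_rat (d i) * sqrt (real r)"
  shows "(diagonal_mat Q \<longrightarrow>
            (\<forall>i<n. totally_le K ((\<eta> $ i)\<^sup>2) (\<gamma> / Q $$ (i,i)) \<and>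
              (of_rat (a i))\<^sup>2 \<le> 1 / 4 * field_trace K (\<gamma> / Q $$ (i,i)) \<and>
              (of_rat (b i))\<^sup>2 \<le> 1 / (4 * real p) * field_trace K (\<gamma> / Q $$ (i,i)) \<and>
              (of_rat (c i))\<^sup>2 \<le> 1 / (4 * real q) * field_trace K (\<gamma> / Q $$ (i,i)) \<and>
              (of_rat (d i))\<^sup>2 \<le> 1 / (4 * real r) * field_trace K (\<gamma> / Q $$ (i,i))))
       \<and> (\<forall>ev :: (real \<Rightarrow> complex) \<Rightarrow> nat \<Rightarrow> real.
            (\<forall>\<sigma>\<in>embeddings K. eigenvalues_of n (embed_mat \<sigma> Q) (ev \<sigma>)) \<longrightarrow>
            (\<forall>i<n. field_trace K ((\<eta> $ i)\<^sup>2)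
                     \<le> (\<Sum>\<sigma>\<in>embeddings K. \<Sum>j<n. Re (\<sigma> \<gamma>) / ev \<sigma> j) \<and>
              (of_rat (a i))\<^sup>2
                     \<le> 1 / 4 * (\<Sum>\<sigma>\<in>embeddings K. \<Sum>j<n. Re (\<sigma> \<gamma>) / ev \<sigma> j) \<and>
              (of_rat (b i))\<^sup>2
                     \<le> 1 / (4 * real p) * (\<Sum>\<sigma>\<in>embeddings K. \<Sum>j<n. Re (\<sigma> \<gamma>) / ev \<sigma> j) \<and>
              (of_rat (c i))\<^sup>2
                     \<le> 1 / (4 * real q) * (\<Sum>\<sigma>\<in>embeddings K. \<Sum>j<n. Re (\<sigma> \<gamma>) / ev \<sigma> j) \<and>
              (of_rat (d i))\<^sup>2
                     \<le> 1 / (4 * real r) * (\<Sum>\<sigma>\<in>embeddings K. \<Sum>j<n. Re (\<sigma> \<gamma>) / ev \<sigma> j)))"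
proof -
  interpret biquadratic p q K by unfold_locales (fact assms)+
  note Q = assms(9,10) and \<eta> = assms(11) and \<gamma> = assms(12)
  \<comment> \<open>Any upper bound \<open>T\<close> of the trace is allowed, so (a) and (b) both
    reduce to bounding the trace of the squared coordinate.\<close>
  have bounds: "(of_rat (a i))\<^sup>2 \<le> 1 / 4 * T \<and> (of_rat (b i))\<^sup>2 \<le> 1 / (4 * real p) * T \<and>
      (of_rat (c i))\<^sup>2 \<le> 1 / (4 * real q) * T \<and> (of_rat (d i))\<^sup>2 \<le> 1 / (4 * real r) * T"
    if "i < n" "field_trace K ((\<eta> $ i)\<^sup>2) \<le> T" for i T
    using coefficient_bounds[OF assms(7) _ that(2)] assms(13) that(1) by blast
  have "totally_le K ((\<eta> $ i)\<^sup>2) (\<gamma> / Q $$ (i,i)) \<and>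
      field_trace K ((\<eta> $ i)\<^sup>2) \<le> field_trace K (\<gamma> / Q $$ (i,i))"
    if "diagonal_mat Q" "i < n" for i
  proof -
    have le: "totally_le K ((\<eta> $ i)\<^sup>2) (\<gamma> / Q $$ (i,i))"
      using diagonal_totally_le[OF Q that(1) \<eta> that(2)] unfolding \<gamma> .
    have "(\<eta> $ i)\<^sup>2 \<in> K"
      using \<eta> that(2) subfield_closed(9)[OF subfield]
      by (simp add: integral_vecs_def ring_of_integers_def)
    with le show ?thesis using field_trace_mono by blast
  qed
  moreover have "field_trace K ((\<eta> $ i)\<^sup>2) \<le> (\<Sum>\<sigma>\<in>embeddings K. \<Sum>j<n. Re (\<sigma> \<gamma>) / ev \<sigma> j)"
    if "\<forall>\<sigma>\<in>embeddings K. eigenvalues_of n (embed_mat \<sigma> Q) (ev \<sigma>)" "i < n"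
    for ev :: "(real \<Rightarrow> complex) \<Rightarrow> nat \<Rightarrow> real" and i
    unfolding field_trace_def
    by (rule sum_mono) (use embedding_square_le[OF Q _ _ \<eta> that(2)] that(1) \<gamma> in auto)
  ultimately show ?thesis using bounds by blast
qed

end
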